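(* Let $T$ be a rank-one transformation with height sets $(H_n)_{n}$ and let $0<\rho\le 1$. If there are a sequence of indices $n_m\to\infty$ and a corresponding sequence $(a_{n_m})$ of positive integers such that $$\lim_{m\to\infty}\frac{\left|(a_{n_m}+H_{n_m})\cap H_{n_m}\right|}{\left|H_{n_m}\right|}=\rho,$$ then $T$ is at least $\rho$-partially rigid.
   Context: A column is an ordered finite collection of pairwise disjoint intervals in $\mathbb R$ of equal length (its levels), thought of as stacked, with heights indexed from $0$; its column map $T_C$ sends each point of a level other than the top one to the point directly above it in the next level. A rank-one (cutting-and-stacking) transformation $T$ is given by columns $C_0,C_1,C_2,\dots$ as follows: $C_0$ is the single level consisting of the unit interval; $C_{n+1}$ is obtained from $C_n$ by cutting $C_n$ into $r_n\ge 2$ subcolumns of equal width, numbered $0,\dots,r_n-1$ from left to right, adding $s_{n,k}\ge 0$ new levels (spacers: intervals of the same length as the subcolumn levels, disjoint from $C_n$ and from each other) above the $k$-th subcolumn, and stacking each subcolumn (with its spacers) under the subcolumn to its right. $X$ is the union of all levels of all columns, $\mu$ is Lebesgue measure on $X$, and $T$ is the pointwise limit of the $T_{C_n}$; it is an invertible (mod null sets) measure-preserving transformation. It is assumed that $\mu(X)=\infty$. Let $h_n$ be the number of levels of $C_n$. The $n$-th height set is $$H_n=\{0\}\cup\Big\{\sum_{k=0}^{\ell}(h_n+s_{n,k}) : 0\le \ell<r_n-1\Big\},$$ so $|H_n|=r_n$. For $0<\rho\le 1$, $T$ is at least $\rho$-partially rigid if for every measurable set $A$ of finite measure there is a sequence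 of integers $q_m\to\infty$ with $\lim_{m\to\infty}\mu(A\cap T^{q_m}A)\ge\rho\,\mu(A)$. For an integer $a$ and a set $H$ of integers, $a+H=\{a+h: h\in H\}$. *)

theory Defs
  imports "HOL-Analysis.Analysis"
begin

text \<open>Levels are taken half-open, so that cutting a level partitions it exactly. A column is
  stored as the common length of its levels and the left endpoints of the levels, bottom to top.\<close>

datatype column = Column (width: real) (left_ends: "real list")

definition height :: "column \<Rightarrow> nat" where
  "height C = length (left_ends C)"

definition level :: "column \<Rightarrow> nat \<Rightarrow> real set" where
  "level C i = {left_ends C ! i ..< left_ends C ! i + width C}"

definition is_column :: "column \<Rightarrow> bool" where
  "is_column C \<longleftrightarrow> width C > 0 \<and> disjoint_family_on (level C) {..<height C}"

text \<open>The value outside the non-top levels is a dummy value.\<close>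

definition column_map :: "column \<Rightarrow> real \<Rightarrow> real" where
  "column_map C x =
    (if \<exists>i. Suc i < height C \<and> x \<in> level C i
     then let i = (THE i. Suc i < height C \<and> x \<in> level C i)
          in x - left_ends C ! i + left_ends C ! Suc i
     else x)"

text \<open>The list \<open>sp k\<close> holds the left endpoints of the spacers put above subcolumn \<open>k\<close>.\<close>

definition subcolumn_ends :: "column \<Rightarrow> nat \<Rightarrow> nat \<Rightarrow> real list" where
  "subcolumn_ends C r k = map (\<lambda>x. x + real k * (width C / real r)) (left_ends C)"

definition cut_and_stack :: "column \<Rightarrow> nat \<Rightarrow> (nat \<Rightarrow> real list) \<Rightarrow> column" where
  "cut_and_stack C r sp =
    Column (width C / real r) (concat (map (\<lambda>k. subcolumn_ends C r k @ sp k) [0..<r]))"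

text \<open>Since the levels of \<open>C (Suc n)\<close> are the cut levels of \<open>C n\<close> together with the spacers,
  the condition \<open>is_column (C (Suc n))\<close> says that the spacers are disjoint from \<open>C n\<close> and from
  each other. The positions of the spacers on the line are otherwise arbitrary.\<close>

locale rank_one =
  fixes r :: "nat \<Rightarrow> nat" and s :: "nat \<Rightarrow> nat \<Rightarrow> nat" and C :: "nat \<Rightarrow> column"
  assumes C_0: "C 0 = Column 1 [0]"
    and cuts: "\<And>n. r n \<ge> 2"
    and C_Suc: "\<And>n. \<exists>sp. (\<forall>k<r n. length (sp k) = s n k) \<and> C (Suc n) = cut_and_stack (C n) (r n) sp"
    and columns: "\<And>n. is_column (C n)"

definition rank_one_space :: "(nat \<Rightarrow> column) \<Rightarrow> real set" where
  "rank_one_space C = (\<Union>n. \<Union>i<height (C n). level (C n) i)"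

text \<open>Each column map extends the previous one, and every point of the space lies in a non-top
  level of \<open>C n\<close> for all large \<open>n\<close>: a point that stayed in the top levels would lie in
  half-open intervals with a common right endpoint and lengths tending to 0. So on the space the
  limit is that of an eventually constant sequence, unaffected by the dummy values.\<close>

definition rank_one_map :: "(nat \<Rightarrow> column) \<Rightarrow> real \<Rightarrow> real" where
  "rank_one_map C x = lim (\<lambda>n. column_map (C n) x)"

definition height_set :: "(nat \<Rightarrow> nat) \<Rightarrow> (nat \<Rightarrow> nat \<Rightarrow> nat) \<Rightarrow> (nat \<Rightarrow> column) \<Rightarrow> nat \<Rightarrow> int set" where
  "height_set r s C n =
    {0} \<union> {(\<Sum>k=0..l. int (height (C n)) + int (s n k)) | l. l < r n - 1}"

text \<open>The set \<open>T\<^sup>q A\<close> for an integer \<open>q\<close>; negative powers are preimages, as \<open>T\<close> need be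
  invertible only up to null sets.\<close>

definition power_image :: "'a measure \<Rightarrow> ('a \<Rightarrow> 'a) \<Rightarrow> int \<Rightarrow> 'a set \<Rightarrow> 'a set" where
  "power_image M T q A =
    (if 0 \<le> q then (T ^^ nat q) ` A else (T ^^ nat (- q)) -` A \<inter> space M)"

definition at_least_partially_rigid :: "'a measure \<Rightarrow> ('a \<Rightarrow> 'a) \<Rightarrow> real \<Rightarrow> bool" where
  "at_least_partially_rigid M T \<rho> \<longleftrightarrow>
    (\<forall>A\<in>sets M. emeasure M A < \<infinity> \<longrightarrow>
      (\<exists>q :: nat \<Rightarrow> int. filterlim q at_top sequentially \<and>
        (\<exists>L. (\<lambda>m. measure M (A \<inter> power_image M T (q m) A)) \<longlonglongrightarrow> L \<and> L \<ge> \<rho> * measure M A)))"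

end

theory Submission
  imports Defs
begin

text \<open>
  Given \<open>A\<close> of finite measure, choose an open \<open>U \<supseteq> A\<close> with \<open>\<mu> (U - A) < \<epsilon>\<close> and let \<open>B\<^sub>n\<close> be
  the union of the levels of \<open>C n\<close> contained in \<open>U\<close>; then \<open>\<mu> (A \<inter> B\<^sub>n) \<rightarrow> \<mu> A\<close>. A level of \<open>C n\<close> is
  cut into \<open>r n\<close> pieces sitting in \<open>C (Suc n)\<close> at heights differing by the elements of \<open>H\<^sub>n\<close>,
  and \<open>T\<^sup>a\<close> moves each piece whose height remains in \<open>H\<^sub>n\<close> after adding \<open>a\<close> onto another piece
  of the same level. So \<open>\<mu> (B\<^sub>n \<inter> T\<^sup>a B\<^sub>n) \<ge> \<mu> B\<^sub>n \<cdot> |(a + H\<^sub>n) \<inter> H\<^sub>n| / |H\<^sub>n|\<close>, and replacing \<open>B\<^sub>n\<close> by \<open>A\<close>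
  costs at most \<open>2 \<epsilon>\<close>. Distinct elements of \<open>H\<^sub>n\<close> differ by at least the height of \<open>C n\<close>,
  which forces \<open>a \<rightarrow> \<infinity>\<close>; a convergent subsequence gives the limit.
\<close>

section \<open>Concatenated lists, levels and column maps\<close>

lemma length_concat_map_upt:
  "length (concat (map f [0..<r])) = (\<Sum>j<r. length (f j))"
  by (induction r) auto

text \<open>Locates the cut levels inside the list built by \<open>cut_and_stack\<close>: the blocks
  before block \<open>k\<close> shift its entries by their total length.\<close>

lemma nth_concat_map_upt:
  assumes "k < r" "i < length (f k)"
  shows "concat (map f [0..<r]) ! ((\<Sum>j<k. length (f j)) + i) = f k ! i"
  using assms
proof (induction r)
  case (Suc r)
  show ?case
  proof (cases "k < r")
    case True
    have "(\<Sum>j<k. length (f j)) + i < (\<Sum>j<Suc k. length (f j))"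
      using Suc.prems by simp
    also have "\<dots> \<le> (\<Sum>j<r. length (f j))"
      using True by (intro sum_mono2) auto
    finally show ?thesis
      using Suc True by (simp add: nth_append length_concat_map_upt del: length_concat)
  next
    case False
    then have "k = r" using Suc.prems by simp
    then show ?thesis
      by (simp add: nth_append length_concat_map_upt del: length_concat)
  qed
qed simp

lemma level_sets_lebesgue [simp]: "level C i \<in> sets lebesgue"
  by (simp add: level_def)

lemma level_lmeasurable [simp]: "level C i \<in> lmeasurable"
  by (rule fmeasurableI2[of "cbox (left_ends C ! i) (left_ends C ! i + width C)"])
    (auto simp: level_def)

lemma measure_level: "0 \<le> width C \<Longrightarrow> measure lebesgue (level C i) = width C"
  by (simp add: level_def)

lemma column_map_level:
  assumes "is_column C" "x \<in> level C i" "Suc i < height C"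
  shows "column_map C x = x - left_ends C ! i + left_ends C ! Suc i"
proof -
  have "(THE i. Suc i < height C \<and> x \<in> level C i) = i"
  proof (rule the_equality)
    fix j assume j: "Suc j < height C \<and> x \<in> level C j"
    have "disjoint_family_on (level C) {..<height C}"
      using assms(1) by (simp add: is_column_def)
    from disjoint_family_onD[OF this, of i j] show "j = i"
      using assms j by auto
  qed (use assms in simp)
  then show ?thesis
    unfolding column_map_def using assms by (auto simp: Let_def)
qed

section \<open>One step of cutting and stacking\<close>

context rank_one
begin

abbreviation X where "X \<equiv> rank_one_space C"
abbreviation T where "T \<equiv> rank_one_map C"
abbreviation h where "h n \<equiv> height (C n)"
abbreviation w where "w n \<equiv> width (C n)"
abbreviation e where "e n i \<equiv> left_ends (C n) ! i"

text \<open>Subcolumn \<open>k\<close> of \<open>C n\<close> starts at height \<open>offset n k\<close> of \<open>C (Suc n)\<close>.\<close>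

definition offset :: "nat \<Rightarrow> nat \<Rightarrow> nat" where
  "offset n k = (\<Sum>j<k. h n + s n j)"

lemma offset_0 [simp]: "offset n 0 = 0"
  and offset_Suc: "offset n (Suc k) = offset n k + h n + s n k"
  by (simp_all add: offset_def)

text \<open>This gap between copies of \<open>C n\<close> gives both the uniqueness of the
  coordinates \<open>(k, i)\<close> of a cut level and the lower bound on the shifts
  \<open>a\<close>.\<close>

lemma offset_add_height_le:
  assumes "k < k'" shows "offset n k + h n \<le> offset n k'"
proof -
  have "offset n (Suc k) \<le> offset n k'"
    unfolding offset_def using assms by (intro sum_mono2) auto
  then show ?thesis by (simp add: offset_Suc)
qed

lemma width_pos [simp]: "0 < w n"
  using columns[of n] by (simp add: is_column_def)

lemma disjoint_levels: "I \<subseteq> {..<h n} \<Longrightarrow> disjoint_family_on (level (C n)) I"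
  using columns[of n] by (auto simp: is_column_def intro: disjoint_family_on_mono)

lemma r_pos [simp]: "0 < r n"
  using cuts[of n] by simp

text \<open>The interface to \<open>cut_and_stack\<close>: all later arguments about
  \<open>C (Suc n)\<close> use these equations instead of the spacer lists.\<close>

lemma width_Suc: "w (Suc n) = w n / real (r n)"
  and height_Suc: "h (Suc n) = offset n (r n)"
  and left_end_Suc: "\<And>k i. k < r n \<Longrightarrow> i < h n \<Longrightarrow> e (Suc n) (offset n k + i) = e n i + real k * w (Suc n)"
proof -
  obtain sp where sp: "\<forall>k<r n. length (sp k) = s n k"
    and C: "C (Suc n) = cut_and_stack (C n) (r n) sp"
    using C_Suc by blast
  let ?f = "\<lambda>k. subcolumn_ends (C n) (r n) k @ sp k"
  have len: "length (?f k) = h n + s n k" if "k < r n" for k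
    using sp that by (simp add: subcolumn_ends_def height_def)
  have off: "(\<Sum>j<k. length (?f j)) = offset n k" if "k \<le> r n" for k
    unfolding offset_def using len that by (intro sum.cong) auto
  show w: "w (Suc n) = w n / real (r n)"
    by (simp add: C cut_and_stack_def)
  show "h (Suc n) = offset n (r n)"
    using off[of "r n"] length_concat_map_upt[of ?f "r n"]
    by (simp add: C cut_and_stack_def height_def del: length_concat)
  show "e (Suc n) (offset n k + i) = e n i + real k * w (Suc n)" if "k < r n" "i < h n" for k i
    using nth_concat_map_upt[of k "r n" i ?f] off[of k] len[of k] that
    unfolding w by (simp add: C cut_and_stack_def nth_append subcolumn_ends_def height_def)
qed

lemma sublevel_bound: "k < r n \<Longrightarrow> i < h n \<Longrightarrow> offset n k + i < h (Suc n)"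
  using offset_add_height_le[of k "r n" n] by (simp add: height_Suc)

lemma sublevel_bound_Suc:
  "k < r n \<Longrightarrow> Suc i < h n \<Longrightarrow> Suc (offset n k + i) < h (Suc n)"
  using sublevel_bound[of k n "Suc i"] by simp

lemma width_eq_Suc: "w n = real (r n) * w (Suc n)"
  by (simp add: width_Suc)

lemma sublevel_subset:
  assumes "k < r n" "i < h n"
  shows "level (C (Suc n)) (offset n k + i) \<subseteq> level (C n) i"
proof -
  have "(real k + 1) * w (Suc n) \<le> w n"
    unfolding width_eq_Suc[of n] using assms by (intro mult_right_mono) (auto simp: less_imp_le)
  moreover have "0 \<le> real k * w (Suc n)" by (simp add: less_imp_le)
  ultimately show ?thesis
    using assms by (auto simp: level_def left_end_Suc distrib_right)
qed

lemma in_sublevel: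
  assumes "x \<in> level (C n) i" "i < h n"
  obtains k where "k < r n" "x \<in> level (C (Suc n)) (offset n k + i)"
proof -
  \<comment> \<open>\<open>y\<close> is the position of \<open>x\<close> within its level, in units
    of the new width; its integer part is the number of the subcolumn containing
    \<open>x\<close>.\<close>
  define y where "y = (x - e n i) / w (Suc n)"
  have y: "0 \<le> y" "y < real (r n)" "x = e n i + y * w (Suc n)"
    using assms width_pos[of "Suc n"] width_eq_Suc[of n]
    by (auto simp: y_def level_def field_simps simp del: width_pos)
  define k where "k = nat \<lfloor>y\<rfloor>"
  have k: "real k \<le> y" "y < real k + 1"
    using y(1) by (auto simp: k_def)
  then have "k < r n" using y(2) by linarith
  moreover have "real k * w (Suc n) \<le> y * w (Suc n)" "y * w (Suc n) < (real k + 1) * w (Suc n)"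
    using k by (auto intro!: mult_right_mono less_imp_le)
  then have "x \<in> level (C (Suc n)) (offset n k + i)"
    using \<open>k < r n\<close> assms y(3) by (auto simp: level_def left_end_Suc distrib_right)
  ultimately show ?thesis by (rule that)
qed

lemma height_ge: "2 ^ n \<le> h n"
proof (induction n)
  case 0
  then show ?case by (simp add: C_0 height_def)
next
  case (Suc n)
  have "2 * h n \<le> r n * h n" using cuts by simp
  also have "\<dots> = (\<Sum>j<r n. h n)" by simp
  also have "\<dots> \<le> h (Suc n)"
    unfolding height_Suc offset_def by (intro sum_mono) auto
  finally show ?case using Suc by simp
qed

lemma height_pos [simp]: "0 < h n"
  using height_ge[of n] by (meson less_le_trans zero_less_numeral zero_less_power)

lemma width_le: "w n \<le> (1/2) ^ n"
proof (induction n)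
  case 0
  then show ?case by (simp add: C_0)
next
  case (Suc n)
  have "w (Suc n) \<le> w n / 2"
    unfolding width_Suc using cuts[of n] by (intro divide_left_mono) (auto simp: less_imp_le)
  then show ?case using Suc by simp
qed

lemma width_tendsto_0: "w \<longlonglongrightarrow> 0"
proof (rule tendsto_sandwich[OF _ _ tendsto_const])
  show "(\<lambda>n. (1/2::real) ^ n) \<longlonglongrightarrow> 0" by (simp add: LIMSEQ_realpow_zero)
qed (auto simp: width_le less_imp_le)

section \<open>The map \<open>T\<close> and its powers on levels\<close>

text \<open>Within subcolumn \<open>k\<close> the left ends of levels \<open>i\<close> and
  \<open>Suc i\<close> are shifted by the same amount, so the translation between them is
  unchanged.\<close>

lemma column_map_extends:
  assumes "x \<in> level (C n) i" "Suc i < h n"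
  obtains j where "x \<in> level (C (Suc n)) j" "Suc j < h (Suc n)"
    "column_map (C (Suc n)) x = column_map (C n) x"
proof -
  obtain k where k: "k < r n" "x \<in> level (C (Suc n)) (offset n k + i)"
    using in_sublevel assms by (metis Suc_lessD)
  have b: "Suc (offset n k + i) < h (Suc n)" using sublevel_bound_Suc k assms by blast
  have "column_map (C (Suc n)) x = column_map (C n) x"
    using column_map_level[OF columns k(2) b] column_map_level[OF columns assms]
      left_end_Suc[OF k(1), of i] left_end_Suc[OF k(1), of "Suc i"] assms by simp
  with k(2) b show ?thesis by (rule that)
qed

lemma rank_one_map_level:
  assumes "x \<in> level (C n) i" "Suc i < h n"
  shows "T x = x - e n i + e n (Suc i)"
proof -
  \<comment> \<open>The induction also carries a non-top level containing \<open>x\<close>, since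
    each application of \<open>column_map_extends\<close> requires one.\<close>
  have "\<exists>j. x \<in> level (C (n + m)) j \<and> Suc j < h (n + m) \<and> column_map (C (n + m)) x = column_map (C n) x" for m
  proof (induction m)
    case 0
    then show ?case using assms by auto
  next
    case (Suc m)
    then obtain j where "x \<in> level (C (n + m)) j" "Suc j < h (n + m)"
      and *: "column_map (C (n + m)) x = column_map (C n) x" by blast
    obtain j' where "x \<in> level (C (Suc (n + m))) j'" "Suc j' < h (Suc (n + m))"
      "column_map (C (Suc (n + m))) x = column_map (C (n + m)) x"
      by (rule column_map_extends[OF \<open>x \<in> level (C (n + m)) j\<close> \<open>Suc j < h (n + m)\<close>])
    then show ?case using * by auto
  qed
  then have const: "column_map (C (n + m)) x = column_map (C n) x" for m
    by blast
  have "\<forall>\<^sub>F m in sequentially. column_map (C m) x = column_map (C n) x"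
    unfolding eventually_sequentially
  proof (intro exI allI impI)
    fix m assume "n \<le> m"
    then show "column_map (C m) x = column_map (C n) x"
      using const[of "m - n"] by simp
  qed
  then have "(\<lambda>m. column_map (C m) x) \<longlonglongrightarrow> column_map (C n) x"
    by (rule tendsto_eventually)
  then show ?thesis
    unfolding rank_one_map_def using column_map_level[OF columns assms] by (simp add: limI)
qed

lemma rank_one_map_funpow_level:
  assumes "x \<in> level (C n) i" "i + q < h n"
  shows "(T ^^ q) x = x - e n i + e n (i + q)"
  using assms
proof (induction q)
  case (Suc q)
  then have IH: "(T ^^ q) x = x - e n i + e n (i + q)" by simp
  have "(T ^^ q) x \<in> level (C n) (i + q)"
    unfolding IH using Suc.prems by (auto simp: level_def)
  from rank_one_map_level[OF this] show ?case using Suc.prems by (simp add: IH)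
qed simp

lemma rank_one_map_funpow_image_level:
  assumes "i + q < h n"
  shows "(T ^^ q) ` level (C n) i = level (C n) (i + q)"
proof -
  have "(T ^^ q) ` level (C n) i = (\<lambda>x. x + (e n (i + q) - e n i)) ` level (C n) i"
    using rank_one_map_funpow_level assms by (intro image_cong) (auto simp: algebra_simps)
  also have "\<dots> = level (C n) (i + q)"
    by (auto simp: level_def image_iff intro!: bexI[of _ "_ - (e n (i + q) - e n i)"])
  finally show ?thesis .
qed

section \<open>Measurability of the space and of images under \<open>T\<close>\<close>

text \<open>Here \<open>T\<close> is already given by \<open>column_map (C n)\<close>, hence by
  finitely many translations. These sets exhaust the space, so facts about \<open>T\<close> are
  obtained on them and passed to the limit.\<close>

definition nontop :: "nat \<Rightarrow> real set" where
  "nontop n = (\<Union>i<h n - 1. level (C n) i)"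

lemma in_nontop_iff: "x \<in> nontop n \<longleftrightarrow> (\<exists>i. Suc i < h n \<and> x \<in> level (C n) i)"
  by (auto simp: nontop_def less_diff_conv)

lemma incseq_nontop: "incseq nontop"
proof (rule incseq_SucI, rule subsetI)
  fix n x assume "x \<in> nontop n"
  then obtain i where "Suc i < h n" "x \<in> level (C n) i" by (auto simp: in_nontop_iff)
  then show "x \<in> nontop (Suc n)"
    using column_map_extends[of x n i] unfolding in_nontop_iff by blast
qed

text \<open>A point staying in top levels forever would keep the distance to a fixed right endpoint
  \<open>R\<close> below every \<open>w n\<close>.\<close>

lemma Union_nontop: "(\<Union>n. nontop n) = X"
proof
  show "(\<Union>n. nontop n) \<subseteq> X"
    by (fastforce simp: rank_one_space_def in_nontop_iff)
  show "X \<subseteq> (\<Union>n. nontop n)"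
  proof (rule subsetI, rule ccontr)
    fix x assume "x \<in> X" and not: "x \<notin> (\<Union>n. nontop n)"
    then have top: "Suc i = h n" if "x \<in> level (C n) i" "i < h n" for n i
      using that in_nontop_iff[of x n] by (metis Suc_lessI UN_I UNIV_I)
    obtain n i where ni: "x \<in> level (C n) i" "i < h n"
      using \<open>x \<in> X\<close> by (auto simp: rank_one_space_def)
    define R where "R = e n i + w n"
    have "\<exists>j<h (n + m). x \<in> level (C (n + m)) j \<and> e (n + m) j + w (n + m) = R" for m
    proof (induction m)
      case 0
      then show ?case using ni by (auto simp: R_def)
    next
      case (Suc m)
      let ?n = "n + m"
      obtain j where j: "j < h ?n" "x \<in> level (C ?n) j" "e ?n j + w ?n = R"
        using Suc by blast
      obtain k where k: "k < r ?n" "x \<in> level (C (Suc ?n)) (offset ?n k + j)"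
        using in_sublevel j by blast
      have b: "offset ?n k + j < h (Suc ?n)" using sublevel_bound k j by blast
      have "Suc (offset ?n k + j) = h (Suc ?n)" using top k(2) b by blast
      \<comment> \<open>Were there a further subcolumn, its copy of \<open>C ?n\<close> would lie
        above \<open>x\<close>, which is in the top level. Being in the last subcolumn preserves the
        right endpoint \<open>R\<close>.\<close>
      have "Suc k = r ?n"
      proof (rule ccontr)
        assume "Suc k \<noteq> r ?n"
        then have "Suc k < r ?n" using k by simp
        from offset_add_height_le[OF this, of ?n] offset_add_height_le[of k "Suc k" ?n]
          \<open>Suc (offset ?n k + j) = h (Suc ?n)\<close> j(1) height_pos[of ?n]
        show False unfolding height_Suc by linarith
      qed
      then have "w ?n = (real k + 1) * w (Suc ?n)"
        using width_eq_Suc[of ?n] by simp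
      then have "e (Suc ?n) (offset ?n k + j) + w (Suc ?n) = R"
        using left_end_Suc[OF k(1) j(1)] j(3) by (simp add: distrib_right)
      then show ?case using b k(2) by auto
    qed
    then have "R - x \<le> w (n + m)" for m
      by (force simp: level_def dest!: spec[of _ m] meta_spec[of _ m])
    moreover have "(\<lambda>m. w (n + m)) \<longlonglongrightarrow> 0"
      using LIMSEQ_ignore_initial_segment[OF width_tendsto_0, of n] by (simp add: add.commute)
    ultimately have "R - x \<le> 0"
      by (intro LIMSEQ_le_const) auto
    then show False using ni by (simp add: R_def level_def)
  qed
qed

lemma nontop_sets: "nontop n \<in> sets lebesgue"
  unfolding nontop_def by (intro sets.finite_UN) auto

lemma rank_one_space_sets: "X \<in> sets lebesgue"
  unfolding Union_nontop[symmetric] by (intro sets.countable_UN) (auto simp: nontop_sets)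

text \<open>On \<open>nontop n\<close> the map translates finitely many disjoint pieces.
  Subadditivity for the images and additivity for the pieces give the bound there; it then passes to
  the increasing union.\<close>

lemma rank_one_map_image:
  assumes "A \<in> sets lebesgue" "A \<subseteq> X"
  shows "T ` A \<in> sets lebesgue" "T ` A \<subseteq> X" "emeasure lebesgue (T ` A) \<le> emeasure lebesgue A"
proof -
  define P where "P n i = T ` (A \<inter> level (C n) i)" for n i
  have P: "P n i \<in> sets lebesgue \<and> emeasure lebesgue (P n i) = emeasure lebesgue (A \<inter> level (C n) i)"
    if "Suc i < h n" for n i
  proof -
    \<comment> \<open>The factor 1 puts the translation into the form of
      \<open>emeasure_lebesgue_affine\<close>.\<close>
    have *: "P n i = (\<lambda>x. 1 *\<^sub>R x + (e n (Suc i) - e n i)) ` (A \<inter> level (C n) i)"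
      unfolding P_def using rank_one_map_level that by (intro image_cong) (auto simp: algebra_simps)
    have "A \<inter> level (C n) i \<in> sets lebesgue" using assms by auto
    then have "P n i \<in> sets lebesgue"
      using lebesgue_sets_translation[of "A \<inter> level (C n) i" "e n (Suc i) - e n i"]
      unfolding * by (simp add: add.commute)
    moreover have "emeasure lebesgue (P n i) = emeasure lebesgue (A \<inter> level (C n) i)"
      unfolding * emeasure_lebesgue_affine by simp
    ultimately show ?thesis by simp
  qed
  define Q where "Q n = T ` (A \<inter> nontop n)" for n
  have Q: "Q n = (\<Union>i<h n - 1. P n i)" for n
    unfolding Q_def P_def nontop_def by auto
  have Qs: "Q n \<in> sets lebesgue" for n
    unfolding Q using P by (intro sets.finite_UN) auto
  have Qe: "emeasure lebesgue (Q n) \<le> emeasure lebesgue A" for n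
  proof -
    have "emeasure lebesgue (Q n) \<le> (\<Sum>i<h n - 1. emeasure lebesgue (P n i))"
      unfolding Q using P by (intro emeasure_subadditive_finite) auto
    also have "\<dots> = (\<Sum>i<h n - 1. emeasure lebesgue (A \<inter> level (C n) i))"
    proof (rule sum.cong)
      fix i assume "i \<in> {..<h n - 1}"
      then have "Suc i < h n" by auto
      with P show "emeasure lebesgue (P n i) = emeasure lebesgue (A \<inter> level (C n) i)" by blast
    qed simp
    also have "\<dots> = emeasure lebesgue (\<Union>i<h n - 1. A \<inter> level (C n) i)"
    proof (rule sum_emeasure)
      show "disjoint_family_on (\<lambda>i. A \<inter> level (C n) i) {..<h n - 1}"
        using disjoint_levels[of "{..<h n - 1}" n]
        by (rule disjoint_family_on_bisimulation) auto
    qed (use assms in auto)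
    also have "\<dots> \<le> emeasure lebesgue A"
      using assms by (intro emeasure_mono) auto
    finally show ?thesis .
  qed
  have TA: "T ` A = (\<Union>n. Q n)"
    using assms Union_nontop unfolding Q_def by blast
  show "T ` A \<in> sets lebesgue"
    unfolding TA using Qs by (intro sets.countable_UN) auto
  show "T ` A \<subseteq> X"
  proof
    fix y assume "y \<in> T ` A"
    then obtain x n i where x: "Suc i < h n" "x \<in> level (C n) i" "y = T x"
      unfolding TA Q_def by (auto simp: in_nontop_iff)
    then have "y \<in> level (C n) (Suc i)"
      using rank_one_map_level[OF x(2,1)] by (auto simp: level_def)
    then show "y \<in> X" using x(1) by (auto simp: rank_one_space_def)
  qed
  have "emeasure lebesgue (T ` A) = (SUP n. emeasure lebesgue (Q n))"
    unfolding TA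
  proof (rule SUP_emeasure_incseq[symmetric])
    show "incseq Q"
      unfolding incseq_def Q_def using incseqD[OF incseq_nontop]
      by (intro allI impI image_mono Int_mono subset_refl)
  qed (use Qs in auto)
  also have "\<dots> \<le> emeasure lebesgue A"
    using Qe by (intro SUP_least)
  finally show "emeasure lebesgue (T ` A) \<le> emeasure lebesgue A" .
qed

lemma rank_one_map_funpow_image:
  assumes "A \<in> sets lebesgue" "A \<subseteq> X"
  shows "(T ^^ q) ` A \<in> sets lebesgue \<and> (T ^^ q) ` A \<subseteq> X \<and>
    emeasure lebesgue ((T ^^ q) ` A) \<le> emeasure lebesgue A"
proof (induction q)
  case (Suc q)
  have "(T ^^ Suc q) ` A = T ` ((T ^^ q) ` A)" by (simp add: image_comp)
  then show ?case
    using Suc rank_one_map_image[of "(T ^^ q) ` A"] by (metis order_trans)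
qed (use assms in auto)


section \<open>Height sets as offsets of subcolumns\<close>

text \<open>As in division with remainder: \<open>i\<close> stays below \<open>h n\<close>, the
  least gap between offsets. This allows levels of \<open>C (Suc n)\<close> to be counted by
  pairs.\<close>

lemma inj_on_offset_add: "inj_on (\<lambda>(k, i). offset n k + i) (UNIV \<times> {..<h n})"
proof (rule inj_onI, clarsimp)
  fix k i k' i' assume "i < h n" "i' < h n" "offset n k + i = offset n k' + i'"
  then show "k = k' \<and> i = i'"
    using offset_add_height_le[of k k' n] offset_add_height_le[of k' k n]
    by (cases k k' rule: linorder_cases) auto
qed

lemma inj_offset: "inj (offset n)"
  using inj_onD[OF inj_on_offset_add[of n], of "(_, 0)" "(_, 0)"] by (auto intro!: injI)

text \<open>The sum up to \<open>l\<close> is the bottom height of subcolumn \<open>Suc l\<close>,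
  and the separate 0 belongs to subcolumn 0. Hence \<open>l < r n - 1\<close> reaches exactly the
  last subcolumn.\<close>

lemma height_set_eq: "height_set r s C n = (\<lambda>k. int (offset n k)) ` {..<r n}"
proof -
  have *: "(\<Sum>k=0..l. int (h n) + int (s n k)) = int (offset n (Suc l))" for l
    by (simp add: offset_def atLeast0AtMost lessThan_Suc_atMost)
  have "{..<r n} = {0} \<union> Suc ` {..<r n - 1}"
    using r_pos[of n] by (simp add: lessThan_Suc_eq_insert_0[symmetric])
  then show ?thesis
    unfolding height_set_def * by auto
qed

lemma card_height_set: "card (height_set r s C n) = r n"
  unfolding height_set_eq using inj_offset[of n]
  by (subst card_image) (auto simp: inj_on_def)

definition common_heights :: "int \<Rightarrow> nat \<Rightarrow> int set" where
  "common_heights a n = (\<lambda>h. a + h) ` height_set r s C n \<inter> height_set r s C n"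

text \<open>A common height makes \<open>a\<close> a difference of two offsets, distinct because
  \<open>0 < a\<close>, so the gap between copies applies.\<close>

lemma height_le_of_common_heights:
  assumes "common_heights a n \<noteq> {}" "0 < a"
  shows "int (h n) \<le> a"
proof -
  obtain k k' where *: "int (offset n k) = a + int (offset n k')"
    using assms(1) unfolding common_heights_def height_set_eq by (auto simp: eq_commute)
  then have "k' < k"
    using assms offset_add_height_le[of k k' n] by (cases k k' rule: linorder_cases) auto
  from offset_add_height_le[OF this, of n] * show ?thesis by linarith
qed

section \<open>Filling an open set with levels\<close>

definition inner_levels :: "real set \<Rightarrow> nat \<Rightarrow> nat set" where
  "inner_levels U n = {i. i < h n \<and> level (C n) i \<subseteq> U}"

definition inner_part :: "real set \<Rightarrow> nat \<Rightarrow> real set" where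
  "inner_part U n = (\<Union>i\<in>inner_levels U n. level (C n) i)"

lemma inner_levels_bound: "inner_levels U n \<subseteq> {..<h n}"
  by (auto simp: inner_levels_def)

lemma finite_inner_levels [simp]: "finite (inner_levels U n)"
  using finite_subset[OF inner_levels_bound] by simp

lemma inner_part_sets [simp]: "inner_part U n \<in> sets lebesgue"
  unfolding inner_part_def by (intro sets.finite_UN) auto

lemma inner_part_subset: "inner_part U n \<subseteq> U" "inner_part U n \<subseteq> X"
  by (auto simp: inner_part_def inner_levels_def rank_one_space_def)

lemma measure_Union_levels:
  assumes "I \<subseteq> {..<h n}"
  shows "measure lebesgue (\<Union>i\<in>I. level (C n) i) = real (card I) * w n"
proof -
  have "finite I" using assms finite_subset by blast
  moreover have "disjoint_family_on (level (C n)) I"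
    using assms by (rule disjoint_levels)
  ultimately have "measure lebesgue (\<Union>i\<in>I. level (C n) i) = (\<Sum>i\<in>I. measure lebesgue (level (C n) i))"
    by (intro measure_finite_Union) (use fmeasurableD2[OF level_lmeasurable] in auto)
  then show ?thesis
    by (simp add: measure_level less_imp_le del: measure_completion)
qed

lemma inner_part_lmeasurable: "inner_part U n \<in> lmeasurable"
  unfolding inner_part_def
  by (intro fmeasurable.finite_UN) auto

text \<open>Cutting a level contained in \<open>U\<close> leaves pieces contained in
  \<open>U\<close>.\<close>

lemma incseq_inner_part: "incseq (inner_part U)"
proof (rule incseq_SucI, rule subsetI)
  fix n x assume "x \<in> inner_part U n"
  then obtain i where i: "i < h n" "level (C n) i \<subseteq> U" "x \<in> level (C n) i"
    by (auto simp: inner_part_def inner_levels_def)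
  obtain k where k: "k < r n" "x \<in> level (C (Suc n)) (offset n k + i)"
    using in_sublevel i by blast
  then show "x \<in> inner_part U (Suc n)"
    using sublevel_subset[OF k(1) i(1)] sublevel_bound[OF k(1) i(1)] i
    unfolding inner_part_def inner_levels_def by blast
qed

lemma in_column_mono:
  assumes "x \<in> level (C n) i" "i < h n" "n \<le> m"
  shows "\<exists>j<h m. x \<in> level (C m) j"
  using assms(3)
proof (induction m rule: dec_induct)
  case base
  then show ?case using assms by blast
next
  case (step m)
  then obtain j where j: "j < h m" "x \<in> level (C m) j" by blast
  then obtain k where "k < r m" "x \<in> level (C (Suc m)) (offset m k + j)"
    using in_sublevel by blast
  with sublevel_bound[OF this(1) j(1)] show ?case by blast
qed

text \<open>Once the width is below the radius of a ball around \<open>x\<close> inside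
  \<open>U\<close>, the level through \<open>x\<close> fits into that ball.\<close>

lemma Union_inner_part:
  assumes "open U"
  shows "(\<Union>n. inner_part U n) = X \<inter> U"
proof
  show "(\<Union>n. inner_part U n) \<subseteq> X \<inter> U"
    using inner_part_subset by blast
  show "X \<inter> U \<subseteq> (\<Union>n. inner_part U n)"
  proof
    fix x assume "x \<in> X \<inter> U"
    then obtain n i where i: "x \<in> level (C n) i" "i < h n"
      by (auto simp: rank_one_space_def)
    obtain d where d: "0 < d" "ball x d \<subseteq> U"
      using assms \<open>x \<in> X \<inter> U\<close> by (auto elim: openE)
    have "\<forall>\<^sub>F m in sequentially. w m < d \<and> n \<le> m"
      using order_tendstoD(2)[OF width_tendsto_0 d(1)] eventually_ge_at_top[of n]
      by (rule eventually_conj)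
    then obtain m where m: "w m < d" "n \<le> m"
      using eventually_happens by force
    obtain j where j: "j < h m" "x \<in> level (C m) j"
      using in_column_mono[OF i m(2)] by blast
    have "level (C m) j \<subseteq> ball x d"
      using j(2) m(1) by (auto simp: level_def dist_real_def)
    then show "x \<in> (\<Union>n. inner_part U n)"
      using j d(2) unfolding inner_part_def inner_levels_def by blast
  qed
qed

text \<open>If \<open>h\<close> and \<open>a + h\<close> are both in \<open>H\<^sub>n\<close> then \<open>T\<^sup>a\<close> carries one copy of \<open>C n\<close> inside
  \<open>C (Suc n)\<close> onto another, level by level.\<close>

lemma measure_inner_part_Int_image:
  assumes "0 \<le> a"
  shows "measure lebesgue (inner_part U n) * (real (card (common_heights a n)) / real (r n))
    \<le> measure lebesgue (inner_part U n \<inter> (T ^^ nat a) ` inner_part U n)"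
proof -
  let ?B = "inner_part U n"
  \<comment> \<open>\<open>K\<close> numbers the copies of \<open>C n\<close> onto which another
    copy is carried by the shift \<open>a\<close>; \<open>I\<close> collects the heights in
    \<open>C (Suc n)\<close> of the pieces of inner levels lying in these copies.\<close>
  define K where "K = {k. k < r n \<and> int (offset n k) \<in> common_heights a n}"
  define I where "I = (\<lambda>(k, i). offset n k + i) ` (K \<times> inner_levels U n)"
  have "common_heights a n \<subseteq> (\<lambda>k. int (offset n k)) ` {..<r n}"
    unfolding common_heights_def height_set_eq by blast
  then have "common_heights a n = (\<lambda>k. int (offset n k)) ` K"
    unfolding K_def by blast
  then have cardK: "card (common_heights a n) = card K"
    using inj_offset[of n] by (auto intro!: card_image simp: inj_on_def)
  have "inj_on (\<lambda>(k, i). offset n k + i) (K \<times> inner_levels U n)"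
    by (rule inj_on_subset[OF inj_on_offset_add[of n]]) (auto simp: inner_levels_def)
  then have cardI: "card I = card K * card (inner_levels U n)"
    unfolding I_def by (simp add: card_image card_cartesian_product)
  have I: "I \<subseteq> {..<h (Suc n)}"
    using sublevel_bound by (auto simp: I_def K_def inner_levels_def)
  have sub: "level (C (Suc n)) (offset n k + i) \<subseteq> ?B" if "k < r n" "i \<in> inner_levels U n" for k i
    using sublevel_subset[OF that(1)] that(2) unfolding inner_part_def inner_levels_def by blast
  have "level (C (Suc n)) (offset n k + i) \<subseteq> ?B \<inter> (T ^^ nat a) ` ?B"
    if k: "k \<in> K" and i: "i \<in> inner_levels U n" for k i
  proof -
    obtain k' where k': "k' < r n" "int (offset n k) = a + int (offset n k')"
      using k by (auto simp: K_def common_heights_def height_set_eq)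
    then have eq: "offset n k + i = offset n k' + i + nat a"
      using assms by linarith
    have "offset n k + i < h (Suc n)"
      using I k i by (auto simp: I_def)
    then have "level (C (Suc n)) (offset n k + i) = (T ^^ nat a) ` level (C (Suc n)) (offset n k' + i)"
      unfolding eq by (rule rank_one_map_funpow_image_level[symmetric])
    also have "\<dots> \<subseteq> (T ^^ nat a) ` ?B"
      using sub[OF k'(1) i] by blast
    finally show ?thesis using sub[of k i] k i by (auto simp: K_def)
  qed
  then have incl: "(\<Union>j\<in>I. level (C (Suc n)) j) \<subseteq> ?B \<inter> (T ^^ nat a) ` ?B"
    unfolding I_def by (intro UN_least) force
  have "measure lebesgue ?B * (real (card (common_heights a n)) / real (r n))
    = real (card (inner_levels U n)) * w n * (real (card K) / real (r n))"
    using measure_Union_levels[OF inner_levels_bound] by (simp add: inner_part_def cardK)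
  also have "\<dots> = real (card I) * w (Suc n)"
    by (simp add: cardI width_Suc)
  also have "\<dots> = measure lebesgue (\<Union>j\<in>I. level (C (Suc n)) j)"
    using measure_Union_levels[OF I] by simp
  also have "\<dots> \<le> measure lebesgue (?B \<inter> (T ^^ nat a) ` ?B)"
  proof (rule measure_mono_fmeasurable[OF incl])
    show "(\<Union>j\<in>I. level (C (Suc n)) j) \<in> sets lebesgue"
      using finite_subset[OF I] by (intro sets.finite_UN) auto
    show "?B \<inter> (T ^^ nat a) ` ?B \<in> lmeasurable"
      using rank_one_map_funpow_image[OF inner_part_sets inner_part_subset(2)]
      by (intro fmeasurable_Int_fmeasurable[OF inner_part_lmeasurable]) auto
  qed
  finally show ?thesis .
qed

section \<open>From unions of levels to arbitrary sets of finite measure\<close>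

lemma rank_one_map_funpow_image_lmeasurable:
  assumes "A \<in> lmeasurable" "A \<subseteq> X"
  shows "(T ^^ q) ` A \<in> lmeasurable" "measure lebesgue ((T ^^ q) ` A) \<le> measure lebesgue A"
proof -
  have *: "(T ^^ q) ` A \<in> sets lebesgue" "emeasure lebesgue ((T ^^ q) ` A) \<le> emeasure lebesgue A"
    using rank_one_map_funpow_image[of A q] assms by (auto simp: fmeasurableD)
  have "emeasure lebesgue A < \<infinity>" using assms(1) by (auto simp: fmeasurable_def)
  then show "(T ^^ q) ` A \<in> lmeasurable"
    using * by (auto simp: fmeasurable_def intro: le_less_trans)
  show "measure lebesgue ((T ^^ q) ` A) \<le> measure lebesgue A"
    unfolding measure_def using * \<open>emeasure lebesgue A < \<infinity>\<close> by (intro enn2real_mono) auto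
qed

text \<open>A point of \<open>B\<close> that is the image of a point of \<open>B\<close> either has
  both points in \<open>A\<close>, or lies in \<open>B - A\<close> or in the image of
  \<open>B - A\<close>. The image is no larger than \<open>B - A\<close>, whence the factor
  2.\<close>

lemma measure_Int_image_approx:
  assumes A: "A \<in> lmeasurable" "A \<subseteq> X" and B: "B \<in> lmeasurable" "B \<subseteq> X"
  shows "measure lebesgue (B \<inter> (T ^^ q) ` B)
    \<le> measure lebesgue (A \<inter> (T ^^ q) ` A) + 2 * measure lebesgue (B - A)"
proof -
  let ?F = "(T ^^ q)"
  have D: "B - A \<in> lmeasurable" "B - A \<subseteq> X"
    using A B by (auto simp: fmeasurable.Diff)
  note FA = rank_one_map_funpow_image_lmeasurable[OF A]
  note FB = rank_one_map_funpow_image_lmeasurable[OF B]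
  note FD = rank_one_map_funpow_image_lmeasurable[OF D]
  have AF: "A \<inter> ?F ` A \<in> lmeasurable" using A FA by (simp add: fmeasurable.Int)
  have "measure lebesgue (B \<inter> ?F ` B) \<le> measure lebesgue ((A \<inter> ?F ` A) \<union> ((B - A) \<union> ?F ` (B - A)))"
    using AF B FB D FD by (intro measure_mono_fmeasurable) (auto simp: fmeasurableD fmeasurable.Un sets.Int)
  also have "\<dots> \<le> measure lebesgue (A \<inter> ?F ` A) + measure lebesgue ((B - A) \<union> ?F ` (B - A))"
    using AF D FD by (intro measure_Un_le) (auto simp: fmeasurableD)
  also have "measure lebesgue ((B - A) \<union> ?F ` (B - A)) \<le> measure lebesgue (B - A) + measure lebesgue (?F ` (B - A))"
    using D FD by (intro measure_Un_le) (auto simp: fmeasurableD)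
  also have "measure lebesgue (?F ` (B - A)) \<le> measure lebesgue (B - A)"
    by (rule FD)
  finally show ?thesis by simp
qed

text \<open>The overlaps of \<open>A\<close> with its images need not converge, so the conclusion is
  an eventual lower bound for each \<open>c\<close> below the target.\<close>

lemma eventually_measure_Int_image_ge:
  fixes n :: "nat \<Rightarrow> nat" and a :: "nat \<Rightarrow> int"
  assumes A: "A \<in> lmeasurable" "A \<subseteq> X"
    and n: "filterlim n at_top sequentially" and a: "\<And>m. 0 \<le> a m"
    and lim: "(\<lambda>m. real (card (common_heights (a m) (n m))) / real (r (n m))) \<longlonglongrightarrow> \<rho>"
    and c: "c < \<rho> * measure lebesgue A"
  shows "\<forall>\<^sub>F m in sequentially. c < measure lebesgue (A \<inter> (T ^^ nat (a m)) ` A)"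
proof -
  \<comment> \<open>The two error sets cost at most \<open>2 * \<epsilon>\<close>, half of the gap
    between \<open>c\<close> and the target, so the inequality stays strict.\<close>
  define \<epsilon> where "\<epsilon> = (\<rho> * measure lebesgue A - c) / 4"
  have "0 < \<epsilon>" using c by (simp add: \<epsilon>_def)
  obtain U where U: "open U" "A \<subseteq> U" "U - A \<in> lmeasurable" "emeasure lebesgue (U - A) < ennreal \<epsilon>"
    using sets_lebesgue_outer_open[OF fmeasurableD[OF A(1)] \<open>0 < \<epsilon>\<close>] by blast
  let ?B = "inner_part U"
  have "measure lebesgue (U - A) \<le> \<epsilon>"
    using U(4) \<open>0 < \<epsilon>\<close> unfolding measure_def by (intro enn2real_leI) auto
  have diff: "measure lebesgue (?B n - A) \<le> \<epsilon>" for n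
  proof -
    have "measure lebesgue (?B n - A) \<le> measure lebesgue (U - A)"
      using U(3) A inner_part_subset(1)[of U n]
      by (intro measure_mono_fmeasurable) (auto simp: fmeasurableD)
    also note \<open>measure lebesgue (U - A) \<le> \<epsilon>\<close>
    finally show ?thesis .
  qed
  have "(\<lambda>n. measure lebesgue (A \<inter> ?B n)) \<longlonglongrightarrow> measure lebesgue (\<Union>n. A \<inter> ?B n)"
  proof (rule Lim_measure_incseq)
    show "range (\<lambda>n. A \<inter> ?B n) \<subseteq> sets lebesgue" using A by (auto simp: fmeasurableD)
    show "incseq (\<lambda>n. A \<inter> ?B n)" using incseq_inner_part[of U] by (auto simp: incseq_def)
    have "emeasure lebesgue (\<Union>n. A \<inter> ?B n) \<le> emeasure lebesgue A"
      using A by (intro emeasure_mono) (auto simp: fmeasurableD)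
    then show "emeasure lebesgue (\<Union>n. A \<inter> ?B n) \<noteq> \<infinity>"
      using fmeasurableD2[OF A(1)] by (auto simp: top_unique)
  qed
  also have "(\<Union>n. A \<inter> ?B n) = A"
    using Union_inner_part[OF U(1)] A(2) U(2) by blast
  finally have "(\<lambda>m. measure lebesgue (A \<inter> ?B (n m))) \<longlonglongrightarrow> measure lebesgue A"
    by (rule filterlim_compose[OF _ n])
  from tendsto_mult[OF this lim]
  have "(\<lambda>m. measure lebesgue (A \<inter> ?B (n m)) * (real (card (common_heights (a m) (n m))) / real (r (n m))))
    \<longlonglongrightarrow> measure lebesgue A * \<rho>" .
  moreover have "c + 2 * \<epsilon> < measure lebesgue A * \<rho>"
    using c by (simp add: \<epsilon>_def field_simps)
  ultimately have "\<forall>\<^sub>F m in sequentially. c + 2 * \<epsilon> <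
      measure lebesgue (A \<inter> ?B (n m)) * (real (card (common_heights (a m) (n m))) / real (r (n m)))"
    by (rule order_tendstoD(1))
  then show ?thesis
  proof eventually_elim
    case (elim m)
    have "measure lebesgue (A \<inter> ?B (n m)) \<le> measure lebesgue (?B (n m))"
      using A inner_part_lmeasurable by (intro measure_mono_fmeasurable) (auto simp: fmeasurableD)
    \<comment> \<open>Chain: enlarge the intersection with \<open>A\<close> to the full inner part,
      apply its overlap estimate, then replace the inner part by \<open>A\<close> at cost
      \<open>2 * \<epsilon>\<close>.\<close>
    from mult_right_mono[OF this, of "real (card (common_heights (a m) (n m))) / real (r (n m))"]
    show ?case
      using elim measure_inner_part_Int_image[OF a, of U "n m" m] diff[of "n m"]
        measure_Int_image_approx[OF A inner_part_lmeasurable inner_part_subset(2), of U "n m" "nat (a m)"]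
      by simp
  qed
qed

lemma filterlim_height_int: "filterlim (\<lambda>n. int (h n)) at_top sequentially"
proof (rule filterlim_at_top_mono)
  show "filterlim int at_top sequentially" by (rule filterlim_int_sequentially)
  show "\<forall>\<^sub>F n in sequentially. int n \<le> int (h n)"
    using height_ge by (intro always_eventually allI)
      (meson less_exp less_imp_le of_nat_mono order_trans)
qed

end

section \<open>Divergence of the shifts and passage to a convergent subsequence\<close>

theorem proposition5p1:
  fixes r :: "nat \<Rightarrow> nat" and s :: "nat \<Rightarrow> nat \<Rightarrow> nat" and C :: "nat \<Rightarrow> column"
    and n :: "nat \<Rightarrow> nat" and a :: "nat \<Rightarrow> int" and \<rho> :: real
  assumes "rank_one r s C"
    and "emeasure lebesgue (rank_one_space C) = \<infinity>"
    and "0 < \<rho>" and "\<rho> \<le> 1"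
    and "filterlim n at_top sequentially"
    and "\<And>m. a (n m) > 0"
    and "(\<lambda>m. real (card ((\<lambda>h. a (n m) + h) ` height_set r s C (n m) \<inter> height_set r s C (n m)))
               / real (card (height_set r s C (n m)))) \<longlonglongrightarrow> \<rho>"
  shows "at_least_partially_rigid (lebesgue_on (rank_one_space C)) (rank_one_map C) \<rho>"
  unfolding at_least_partially_rigid_def
proof (intro ballI impI)
  interpret rank_one r s C by fact
  let ?M = "lebesgue_on X"
  fix A assume "A \<in> sets ?M" and "emeasure ?M A < \<infinity>"
  have X: "X \<inter> space lebesgue \<in> sets lebesgue" using rank_one_space_sets by simp
  have A: "A \<in> lmeasurable" "A \<subseteq> X"
    using \<open>A \<in> sets ?M\<close> \<open>emeasure ?M A < \<infinity>\<close> sets_restrict_space_iff[OF X] emeasure_restrict_space[OF X]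
    by (auto simp: fmeasurable_def)
  have lim: "(\<lambda>m. real (card (common_heights (a (n m)) (n m))) / real (r (n m))) \<longlonglongrightarrow> \<rho>"
    using assms(7) by (simp add: common_heights_def card_height_set)
  \<comment> \<open>Since \<open>0 < \<rho>\<close>, the ratios are eventually positive, so common
    heights exist and bound \<open>a (n m)\<close> from below.\<close>
  have "\<forall>\<^sub>F m in sequentially. int (h (n m)) \<le> a (n m)"
    using order_tendstoD(1)[OF lim \<open>0 < \<rho>\<close>]
  proof eventually_elim
    case (elim m)
    then have "common_heights (a (n m)) (n m) \<noteq> {}" by auto
    then show ?case using assms(6) by (rule height_le_of_common_heights)
  qed
  with filterlim_compose[OF filterlim_height_int assms(5)]
  have a_top: "filterlim (\<lambda>m. a (n m)) at_top sequentially"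
    by (rule filterlim_at_top_mono)
  define f where "f m = measure lebesgue (A \<inter> (T ^^ nat (a (n m))) ` A)" for m
  have "f m \<in> {0..measure lebesgue A}" for m
    unfolding f_def using A rank_one_map_funpow_image_lmeasurable[OF A]
    by (auto intro!: measure_mono_fmeasurable simp: fmeasurableD sets.Int)
  \<comment> \<open>Partial rigidity asks for an actual limit; compactness of the interval
    containing all values of \<open>f\<close> supplies one along a subsequence.\<close>
  then obtain L \<sigma> where \<sigma>: "strict_mono \<sigma>" and L: "(f \<circ> \<sigma>) \<longlonglongrightarrow> L"
    using compact_Icc[of 0 "measure lebesgue A"] unfolding compact_def by metis
  have "\<rho> * measure lebesgue A \<le> L"
  \<comment> \<open>A \<open>c\<close> strictly between \<open>L\<close> and the target would
    eventually be a lower bound for \<open>f\<close>, hence for the subsequence, contradicting its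
    limit \<open>L\<close>.\<close>
  proof (rule dense_ge)
    fix c assume "L < c"
    show "\<rho> * measure lebesgue A \<le> c"
    proof (rule ccontr)
      assume "\<not> \<rho> * measure lebesgue A \<le> c"
      then have "\<forall>\<^sub>F m in sequentially. c < f m"
        unfolding f_def using assms(6)
        by (intro eventually_measure_Int_image_ge[OF A assms(5) _ lim]) (auto simp: less_imp_le)
      from eventually_subseq[OF \<sigma> this] have "\<forall>\<^sub>F m in sequentially. c \<le> (f \<circ> \<sigma>) m"
        by (rule eventually_mono) simp
      with L have "c \<le> L" by (rule tendsto_lowerbound) simp
      then show False using \<open>L < c\<close> by simp
    qed
  qed
  moreover have "measure ?M A = measure lebesgue A"
    using measure_restrict_space[OF X A(2)] .
  moreover have "measure ?M (A \<inter> power_image ?M T (a (n (\<sigma> m))) A) = (f \<circ> \<sigma>) m" for m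
  proof -
    have "measure ?M (A \<inter> B) = measure lebesgue (A \<inter> B)" for B
      using A(2) by (intro measure_restrict_space[OF X]) auto
    \<comment> \<open>Positivity of \<open>a\<close> selects the forward-image branch of
      \<open>power_image\<close>.\<close>
    then show ?thesis
      using assms(6)[of "\<sigma> m"] by (simp add: f_def power_image_def less_imp_le)
  qed
  ultimately show "\<exists>q. filterlim q at_top sequentially \<and>
      (\<exists>L. (\<lambda>m. measure ?M (A \<inter> power_image ?M T (q m) A)) \<longlonglongrightarrow> L \<and> \<rho> * measure ?M A \<le> L)"
    using L filterlim_compose[OF a_top filterlim_subseq[OF \<sigma>]]
    by (intro exI[of _ "\<lambda>m. a (n (\<sigma> m))"] conjI exI[of _ L]) (auto simp: comp_def)
qed

end
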